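(* Let $s,w:(0,\infty)\to(0,\infty)$ be nondecreasing, with $s$ locally integrable on $[0,\infty)$, let $K:(0,\infty)\times(0,\infty)\to\mathbb{C}$ be continuous with $|K(x,y)|\lesssim\min\{1,(s(x)w(y))^{-1/2}\}$ for $x,y>0$, and for $f$ as described in the context let $$Ff(y)=\int_0^\infty s(x)f(x)K(x,y)\,dx,\qquad y>0.$$ Let $1<p,q<\infty$, $1\le a\le\infty$, and let $u,v$ be nonnegative measurable functions on $(0,\infty)$ such that $uw^{q/a'}$ and $v^{1-p'}s^{p'/a'}$ are locally integrable on $[0,\infty)$. Assume that the inequality $$\Vert w^{1/a'}Ff\Vert_{q,u}\lesssim\Vert s^{1/a}f\Vert_{p,v}$$ holds for every such $f$, with a constant independent of $f$. (i) If $K(x,y)\asymp1$ for $0<xy\le1$, then there exists $C>0$ such that $$\sup_{r>0}\bigg(\int_0^{1/r}u(y)w(y)^{q/a'}\,dy\bigg)^{1/q}\bigg(\int_0^r v(x)^{1-p'}s(x)^{p'/a'}\,dx\bigg)^{1/p'}\le C.$$ (ii) If $K(x,y)\asymp(s(x)w(y))^{-1/2}$ for $xy>1$, then there exists $C>0$ such that $$\sup_{r>0}\bigg(\int_{1/r}^\infty u(y)w(y)^{q(1/a'-1/2)}\,dy\bigg)^{1/q}\bigg(\int_r^\infty v(x)^{1-p'}s(x)^{p'(1/a'-1/2)}\,dx\bigg)^{1/p'}\le C.$$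
   Context: Notation: for $0<p<\infty$ and a nonnegative measurable function $v$ on $(0,\infty)$, $\Vert f\Vert_{p,v}=\big(\int_0^\infty v(x)|f(x)|^p\,dx\big)^{1/p}$ (possibly $+\infty$). For $1\le a\le\infty$, $a'=a/(a-1)$ is the dual exponent ($1/a+1/a'=1$, with $1/\infty=0$). $A\lesssim B$ means $A\le cB$ with a constant $c>0$ independent of the essential variables ($x,y,f$); $A\asymp B$ means $A\lesssim B\lesssim A$ (in particular $K$ is real and positive in the region where $K\asymp\cdots$ is assumed). Conventions: $0\cdot\infty=0$, and $v^{1-p'}=\infty$ where $v=0$. Functions $f$: $f:(0,\infty)\to\mathbb{C}$ is measurable and satisfies $\int_0^1 s(x)|f(x)|\,dx+\int_1^\infty s(x)^{1/2}|f(x)|\,dx<\infty$, so that $Ff(y)$ is well defined for every $y>0$. *)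

theory Defs
  imports "HOL-Analysis.Analysis"
begin

text \<open>
  Functions on \<open>(0,\<infinity>)\<close> are functions on \<^typ>\<open>real\<close> of which only the restriction to
  \<^term>\<open>{0<..} :: real set\<close> matters; measurability is Lebesgue measurability on that set.
\<close>

text \<open>The special case is needed because \<open>\<infinity> / \<infinity> = 0\<close> in \<^typ>\<open>ereal\<close>;
  for \<open>a = 1\<close> the quotient is \<open>1 / 0 = \<infinity>\<close>, as wanted.\<close>

definition dual_exponent :: "ereal \<Rightarrow> ereal" where
  "dual_exponent a = (if a = \<infinity> then 1 else a / (a - 1))"

text \<open>The number \<open>1/a\<close>, with \<open>1/\<infinity> = 0\<close>.\<close>

definition recip :: "ereal \<Rightarrow> real" where
  "recip a = real_of_ereal (1 / a)"

lemma dual_exponent_simps [simp]: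
  "dual_exponent \<infinity> = 1" "dual_exponent 1 = \<infinity>"
  by (simp_all add: dual_exponent_def divide_ereal_def one_ereal_def)

lemma recip_add_recip_dual_exponent:
  assumes "1 \<le> a"
  shows "recip a + recip (dual_exponent a) = 1"
proof (cases a)
  case (real r)
  then show ?thesis
    using assms
    by (cases "r = 1") (auto simp: recip_def dual_exponent_def one_ereal_def divide_ereal_def
        field_simps)
qed (use assms in \<open>auto simp: recip_def\<close>)

text \<open>\<open>x\<^sup>t\<close> on \<open>[0,\<infinity>]\<close>, meant for exponents \<open>t > 0\<close> only.\<close>

definition ennpow :: "ennreal \<Rightarrow> real \<Rightarrow> ennreal" where
  "ennpow x t = (if x = \<infinity> then \<infinity> else ennreal (enn2real x powr t))"

text \<open>\<open>x\<^sup>t\<close> for \<open>x \<ge> 0\<close>, meant for exponents \<open>t < 0\<close> only, with \<open>0\<^sup>t = \<infinity>\<close>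
  (whereas \<open>0 powr t = 0\<close>).\<close>

definition negpow :: "real \<Rightarrow> real \<Rightarrow> ennreal" where
  "negpow x t = (if x = 0 then \<infinity> else ennreal (x powr t))"

text \<open>Local integrability on \<open>[0,\<infinity>)\<close>, that is, including integrability near \<open>0\<close>,
  of a measurable function with values in \<open>[0,\<infinity>]\<close>.\<close>

definition loc_integrable :: "(real \<Rightarrow> ennreal) \<Rightarrow> bool" where
  "loc_integrable g \<longleftrightarrow>
     g \<in> borel_measurable (lebesgue_on {0<..}) \<and>
     (\<forall>b>0. (\<integral>\<^sup>+x\<in>{0<..b}. g x \<partial>lebesgue) < \<infinity>)"

definition weighted_norm :: "real \<Rightarrow> (real \<Rightarrow> real) \<Rightarrow> (real \<Rightarrow> complex) \<Rightarrow> ennreal" where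
  "weighted_norm p v f =
     ennpow (\<integral>\<^sup>+x\<in>{0<..}. ennreal (v x * cmod (f x) powr p) \<partial>lebesgue) (1 / p)"

definition admissible :: "(real \<Rightarrow> real) \<Rightarrow> (real \<Rightarrow> complex) \<Rightarrow> bool" where
  "admissible s f \<longleftrightarrow>
     f \<in> borel_measurable (lebesgue_on {0<..}) \<and>
     (\<integral>\<^sup>+x\<in>{0<..1}. ennreal (s x * cmod (f x)) \<partial>lebesgue)
       + (\<integral>\<^sup>+x\<in>{1<..}. ennreal (s x powr (1/2) * cmod (f x)) \<partial>lebesgue) < \<infinity>"

definition transform ::
    "(real \<Rightarrow> real) \<Rightarrow> (real \<Rightarrow> real \<Rightarrow> complex) \<Rightarrow> (real \<Rightarrow> complex) \<Rightarrow> real \<Rightarrow> complex" where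
  "transform s K f y =
     (LINT x|lebesgue_on {0<..}. complex_of_real (s x) * f x * K x y)"

text \<open>\<open>K \<asymp> G\<close> on \<open>D\<close> for complex-valued \<open>K\<close> and positive \<open>G\<close>; in particular
  \<open>K\<close> is real and positive on \<open>D\<close>.\<close>

definition comparable_on ::
    "(real \<times> real) set \<Rightarrow> (real \<Rightarrow> real \<Rightarrow> complex) \<Rightarrow> (real \<Rightarrow> real \<Rightarrow> real) \<Rightarrow> bool" where
  "comparable_on D K G \<longleftrightarrow>
     (\<exists>c1>0. \<exists>c2>0. \<forall>(x, y)\<in>D.
        K x y \<in> \<real> \<and> c1 * G x y \<le> Re (K x y) \<and> Re (K x y) \<le> c2 * G x y)"

end

theory Submission
  imports Defs
begin

text \<open>
  Both bounds come from testing the assumed inequality on one explicit function. Write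
  \<open>\<beta> = 1/a'\<close>, so that \<open>1/a = 1 - \<beta>\<close>, and let \<open>\<gamma> = 0\<close> in (i), \<open>\<gamma> = 1/2\<close> in (ii). On a
  rectangle \<open>A \<times> B\<close> inside the region of (i), where \<open>xy \<le> 1\<close>, or of (ii), where \<open>xy > 1\<close>, the kernel is at least a multiple of \<open>(s(x) w(y)) powr (-\<gamma>)\<close>.
  Let \<open>g = v powr (1 - p') * s powr (p' (\<beta> - \<gamma>))\<close> be the integrand of the factor in \<open>v\<close>, restricted
  to \<open>A\<close>, let \<open>I\<close> be its integral, and take \<open>f = g * s powr (\<gamma> - 1)\<close>. This choice does two things.

  \<^item> The powers of \<open>s\<close> in \<open>s f K\<close> reduce to \<open>g\<close>, and \<open>s f K \<ge> 0\<close>, so for \<open>y\<close> in \<open>B\<close> the transform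
    is at least a multiple of \<open>w(y) powr (-\<gamma>) * I\<close>. The left-hand norm is thus at least a multiple of
    \<open>I * J powr (1/q)\<close>, where \<open>J\<close> is the integral of \<open>u w powr (q (\<beta> - \<gamma>))\<close> over \<open>B\<close>.
  \<^item> By \<open>p p' = p + p'\<close>, the integrand \<open>v |s powr (1 - \<beta>) f| powr p\<close> of the right-hand norm is
    \<open>g\<close> again, so that norm is \<open>I powr (1/p)\<close>.

  Dividing by \<open>I powr (1/p)\<close> gives the claim, with a constant that does not depend on \<open>A\<close> and
  \<open>B\<close>. The case \<open>I = 0\<close> is trivial; otherwise the division requires \<open>I < \<infinity>\<close>, and \<open>f\<close> has to be
  admissible, which it is when moreover \<open>A\<close> is bounded (\<open>test_function_bound\<close>). In (i), \<open>A = (0,r)\<close> and \<open>B = (0,1/r)\<close>,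
  and \<open>I\<close> is finite by local integrability. In (ii), \<open>B = (1/r,\<infinity>)\<close> and the interval
  \<open>(r,\<infinity>)\<close> is exhausted by bounded intervals, on each of which \<open>s\<close> is bounded below by \<open>s(r)\<close>, so that
  local integrability gives \<open>I < \<infinity>\<close>; monotone convergence then gives the result on all of
  \<open>(r,\<infinity>)\<close>, even if the factor in \<open>v\<close> is not known to be finite beforehand.
\<close>

section \<open>Powers on \<open>[0,\<infinity>]\<close>\<close>

lemma ennpow_ennreal [simp]: "0 \<le> x \<Longrightarrow> ennpow (ennreal x) t = ennreal (x powr t)"
  by (simp add: ennpow_def)

lemma ennpow_top [simp]: "ennpow \<infinity> t = \<infinity>" "ennpow top t = top"
  by (simp_all add: ennpow_def)

lemma ennpow_0 [simp]: "ennpow 0 t = 0"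
  by (simp add: ennpow_def)

lemma ennpow_mult: "ennpow (x * y) t = ennpow x t * ennpow y t"
proof (cases x; cases y)
  fix c d assume "0 \<le> c" "x = ennreal c" "0 \<le> d" "y = ennreal d"
  then show ?thesis
    by (simp add: powr_mult flip: ennreal_mult)
next
  fix c assume "0 \<le> c" "x = ennreal c" "y = top"
  then show ?thesis
    by (cases "c = 0") (auto simp: ennreal_mult_top)
next
  fix d assume "x = top" "0 \<le> d" "y = ennreal d"
  then show ?thesis
    by (cases "d = 0") (auto simp: ennreal_top_mult)
qed simp

lemma ennpow_mono:
  assumes "x \<le> y" "0 \<le> t"
  shows "ennpow x t \<le> ennpow y t"
  using assms
  by (cases x; cases y) (auto simp: powr_mono2 top_unique intro!: ennreal_leI)

lemma ennpow_inverse: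
  assumes "0 < t"
  shows "ennpow (ennpow x t) (1 / t) = x" "ennpow (ennpow x (1 / t)) t = x"
  using assms by (cases x; simp add: powr_powr)+

lemma ennpow_le_iff:
  assumes "0 < t"
  shows "ennpow x t \<le> z \<longleftrightarrow> x \<le> ennpow z (1 / t)"
proof
  assume "ennpow x t \<le> z"
  then have "ennpow (ennpow x t) (1 / t) \<le> ennpow z (1 / t)"
    using assms by (intro ennpow_mono) auto
  then show "x \<le> ennpow z (1 / t)"
    using assms by (simp add: ennpow_inverse)
next
  assume "x \<le> ennpow z (1 / t)"
  then have "ennpow x t \<le> ennpow (ennpow z (1 / t)) t"
    using assms by (intro ennpow_mono) auto
  then show "ennpow x t \<le> z"
    using assms by (simp add: ennpow_inverse)
qed

text \<open>A power with positive exponent is an order automorphism of \<open>[0,\<infinity>]\<close> and hence commutes with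
  suprema. This turns monotone convergence of integrals into convergence of norms.\<close>

lemma ennpow_SUP:
  assumes "0 < t"
  shows "ennpow (SUP i\<in>I. f i) t = (SUP i\<in>I. ennpow (f i) t)"
proof (rule antisym)
  have "ennpow (f i) t \<le> (SUP i\<in>I. ennpow (f i) t)" if "i \<in> I" for i
    using that by (rule SUP_upper)
  then show "ennpow (SUP i\<in>I. f i) t \<le> (SUP i\<in>I. ennpow (f i) t)"
    using assms by (auto simp: ennpow_le_iff intro!: SUP_least)
  show "(SUP i\<in>I. ennpow (f i) t) \<le> ennpow (SUP i\<in>I. f i) t"
    using assms by (intro SUP_least ennpow_mono SUP_upper) auto
qed

section \<open>Integrals and measurability on the half-line\<close>

lemma nn_integral_lebesgue_on_Ioi:
  assumes "A \<subseteq> {0<..}"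
  shows "(\<integral>\<^sup>+x\<in>A. f x \<partial>lebesgue) = (\<integral>\<^sup>+x. f x * indicator A x \<partial>lebesgue_on {0::real<..})"
proof -
  have "f x * indicator A x = f x * indicator A x * indicator {0<..} x" for x
    using assms by (auto simp: indicator_def)
  then have "(\<integral>\<^sup>+x\<in>A. f x \<partial>lebesgue) = (\<integral>\<^sup>+x. f x * indicator A x * indicator {0<..} x \<partial>lebesgue)"
    by (metis (no_types, lifting))
  also have "\<dots> = (\<integral>\<^sup>+x. f x * indicator A x \<partial>lebesgue_on {0<..})"
    by (subst nn_integral_restrict_space) auto
  finally show ?thesis .
qed

lemma mono_on_measurable_Ioi:
  fixes f :: "real \<Rightarrow> real"
  assumes "mono_on {0<..} f"
  shows "f \<in> borel_measurable (lebesgue_on {0<..})"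
proof (rule measurableI)
  fix T :: "real set" assume T: "T \<in> sets borel"
  have "f -` T \<inter> {0<..} \<in> sets (restrict_space borel {0<..})"
    using measurable_sets[OF borel_measurable_mono_on_fnc[OF assms] T]
    by (simp add: space_restrict_space)
  then have "f -` T \<inter> {0<..} \<in> sets borel"
    by (subst (asm) sets_restrict_space_iff) auto
  then have "f -` T \<inter> {0<..} \<in> sets (lebesgue_on {0<..})"
    by (subst sets_restrict_space_iff) auto
  then show "f -` T \<inter> space (lebesgue_on {0<..}) \<in> sets (lebesgue_on {0<..})"
    by simp
qed auto

lemma sets_lebesgue_on_Ioi:
  assumes "A \<in> sets borel" "A \<subseteq> {0::real<..}"
  shows "A \<in> sets (lebesgue_on {0<..})"
  using assms by (auto simp: sets_restrict_space_iff)

section \<open>The test function\<close>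

text \<open>
  Testing with \<open>f = g * s powr (\<gamma> - 1)\<close>, where \<open>g\<close> is the second integrand cut off to \<open>A\<close>, gives
  \<open>c1 * I * J powr (1/q) \<le> c * I powr (1/p)\<close> for the two integrals \<open>J\<close> and \<open>I\<close> in the conclusion.
  Boundedness of \<open>A\<close> makes \<open>f\<close> admissible: there \<open>s |f| = g * s powr \<gamma>\<close> is at most a constant
  times \<open>g\<close>. The parameter \<open>\<gamma>\<close> is the decay exponent of the kernel on \<open>A \<times> B\<close>, which lets one
  argument serve the two regions.
\<close>

lemma test_function_bound:
  fixes s w u v :: "real \<Rightarrow> real"
    and K :: "real \<Rightarrow> real \<Rightarrow> complex"
    and p p' q \<alpha> \<beta> \<gamma> k c c1 R :: real
    and A B :: "real set"
  assumes s_pos: "\<And>x. 0 < x \<Longrightarrow> 0 < s x"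
    and w_pos: "\<And>y. 0 < y \<Longrightarrow> 0 < w y"
    and s_mono: "mono_on {0<..} s"
    and w_mono: "mono_on {0<..} w"
    and K_meas: "\<And>y. 0 < y \<Longrightarrow> (\<lambda>x. K x y) \<in> borel_measurable (lebesgue_on {0<..})"
    and K_bdd: "\<And>x y. 0 < x \<Longrightarrow> 0 < y \<Longrightarrow> cmod (K x y) \<le> k"
    and p: "1 < p" and p': "p' = p / (p - 1)" and q: "0 < q"
    and \<alpha>\<beta>: "\<alpha> + \<beta> = 1" and \<gamma>: "0 \<le> \<gamma>"
    and u_meas: "u \<in> borel_measurable (lebesgue_on {0<..})"
    and u_nonneg: "\<And>y. 0 < y \<Longrightarrow> 0 \<le> u y"
    and v_meas: "v \<in> borel_measurable (lebesgue_on {0<..})"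
    and v_nonneg: "\<And>x. 0 < x \<Longrightarrow> 0 \<le> v x"
    and ineq: "\<And>f. admissible s f \<Longrightarrow>
        weighted_norm q u (\<lambda>y. complex_of_real (w y powr \<beta>) * transform s K f y)
          \<le> ennreal c * weighted_norm p v (\<lambda>x. complex_of_real (s x powr \<alpha>) * f x)"
    and c: "0 < c" and c1: "0 < c1"
    and A: "A \<in> sets borel" "A \<subseteq> {0<..R}"
    and B: "B \<in> sets borel" "B \<subseteq> {0<..}"
    and K_low: "\<And>x y. x \<in> A \<Longrightarrow> y \<in> B \<Longrightarrow>
        K x y \<in> \<real> \<and> c1 * (s x * w y) powr (-\<gamma>) \<le> Re (K x y)"
    and I_fin: "(\<integral>\<^sup>+x\<in>A. negpow (v x) (1 - p') * ennreal (s x powr (p' * (\<beta> - \<gamma>)))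
        \<partial>lebesgue) < \<infinity>" (is "?I < \<infinity>")
  shows "ennpow (\<integral>\<^sup>+y\<in>B. ennreal (u y * w y powr (q * (\<beta> - \<gamma>))) \<partial>lebesgue) (1 / q)
      * ennpow (\<integral>\<^sup>+x\<in>A. negpow (v x) (1 - p') * ennreal (s x powr (p' * (\<beta> - \<gamma>)))
          \<partial>lebesgue) (1 / p') \<le> ennreal (c / c1)"
    (is "ennpow ?J _ * _ \<le> _")
proof -
  let ?M = "lebesgue_on {0::real<..}"
  have [measurable]: "s \<in> borel_measurable ?M" "w \<in> borel_measurable ?M"
    "u \<in> borel_measurable ?M" "v \<in> borel_measurable ?M"
    using s_mono w_mono u_meas v_meas by (simp_all add: mono_on_measurable_Ioi)
  have [measurable]: "A \<in> sets ?M" "B \<in> sets ?M"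
    using A B by (auto intro!: sets_lebesgue_on_Ioi)
  have A0: "A \<subseteq> {0<..}" using A by auto
  have p'p: "1 / p + 1 / p' = 1" and p'_mult: "p * p' = p + p'"
    using p by (auto simp: p' field_simps)
  define g where "g x = indicator A x * (v x powr (1 - p') * s x powr (p' * (\<beta> - \<gamma>)))" for x
  define f where "f x = complex_of_real (g x * s x powr (\<gamma> - 1))" for x
  have [measurable]: "g \<in> borel_measurable ?M"
    unfolding g_def by measurable
  have [measurable]: "f \<in> borel_measurable ?M"
    unfolding f_def by measurable
  have g_nonneg: "0 \<le> g x" for x
    by (simp add: g_def)
  have I_M: "?I = (\<integral>\<^sup>+x. negpow (v x) (1 - p') * ennreal (s x powr (p' * (\<beta> - \<gamma>)))
      * indicator A x \<partial>?M)"
    by (rule nn_integral_lebesgue_on_Ioi[OF A0])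
  have [measurable]: "(\<lambda>x. negpow (v x) (1 - p')) \<in> borel_measurable ?M"
    unfolding negpow_def by measurable
  \<comment> \<open>Finiteness of the integral forces \<open>v > 0\<close> almost everywhere on \<open>A\<close>, so the convention
    \<open>0 powr (1 - p') = 0\<close> implicit in \<open>g\<close> does no harm.\<close>
  have I_g: "?I = (\<integral>\<^sup>+x. ennreal (g x) \<partial>?M)"
  proof -
    have "AE x in ?M. negpow (v x) (1 - p') * ennreal (s x powr (p' * (\<beta> - \<gamma>)))
        * indicator A x \<noteq> \<infinity>"
      using I_fin unfolding I_M by (intro nn_integral_noteq_infinite) auto
    then have "AE x in ?M. negpow (v x) (1 - p') * ennreal (s x powr (p' * (\<beta> - \<gamma>)))
        * indicator A x = ennreal (g x)"
    proof (rule AE_mp, intro AE_I2 impI)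
      fix x assume x: "x \<in> space ?M" and fin: "negpow (v x) (1 - p')
        * ennreal (s x powr (p' * (\<beta> - \<gamma>))) * indicator A x \<noteq> \<infinity>"
      have "s x > 0" using s_pos x by simp
      then show "negpow (v x) (1 - p') * ennreal (s x powr (p' * (\<beta> - \<gamma>))) * indicator A x
          = ennreal (g x)"
        using fin
        by (auto simp: g_def negpow_def indicator_def ennreal_top_mult ennreal_mult
            split: if_splits)
    qed
    then show ?thesis
      unfolding I_M by (rule nn_integral_cong_AE)
  qed
  define i where "i = (LINT x|?M. g x)"
  have g_int: "integrable ?M g"
    using I_fin g_nonneg unfolding I_g by (intro integrableI_nonneg) auto
  have I_i: "?I = ennreal i"
    unfolding I_g i_def using g_int g_nonneg by (intro nn_integral_eq_integral) auto
  have i_nonneg: "0 \<le> i"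
    unfolding i_def using g_nonneg by simp
  have sf: "s x * cmod (f x) = g x * s x powr \<gamma>" if "0 < x" for x
    using s_pos[OF that] g_nonneg[of x] by (simp add: f_def norm_mult norm_divide powr_diff)
  have sf_le: "s x * cmod (f x) \<le> s R powr \<gamma> * g x" if "0 < x" for x
  proof (cases "x \<in> A")
    case True
    then have "x \<le> R" using A by auto
    then have "s x \<le> s R"
      using that s_mono by (auto simp: mono_on_def)
    then have "s x powr \<gamma> \<le> s R powr \<gamma>"
      using s_pos[OF that] \<gamma> by (intro powr_mono2) auto
    then show ?thesis
      using g_nonneg[of x] unfolding sf[OF that] by (simp add: mult.commute mult_left_mono)
  next
    case False
    then show ?thesis by (simp add: f_def g_def)
  qed
  have g_dom: "(\<integral>\<^sup>+x. ennreal (d * g x) \<partial>?M) < \<infinity>" if "0 \<le> d" for d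
    using g_int g_nonneg that
    by (subst nn_integral_eq_integral) auto
  have f_adm: "admissible s f"
  proof -
    have "(\<integral>\<^sup>+x\<in>{0<..1}. ennreal (s x * cmod (f x)) \<partial>lebesgue) 
        \<le> (\<integral>\<^sup>+x. ennreal (s R powr \<gamma> * g x) \<partial>?M)"
      using sf_le g_nonneg
      by (subst nn_integral_lebesgue_on_Ioi)
        (auto intro!: nn_integral_mono ennreal_leI simp: indicator_def)
    also have "\<dots> < \<infinity>" by (rule g_dom) simp
    finally have 1: "(\<integral>\<^sup>+x\<in>{0<..1}. ennreal (s x * cmod (f x)) \<partial>lebesgue) < \<infinity>" .
    \<comment> \<open>Beyond \<open>1\<close>, the weight \<open>s powr (1/2)\<close> is dominated by \<open>s\<close> because \<open>s \<ge> s(1) > 0\<close>.\<close>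
    have root_le: "s x powr (1/2) * cmod (f x) \<le> s 1 powr (-1/2) * s R powr \<gamma> * g x"
      if "1 < x" for x
    proof -
      have s1: "0 < s 1" "s 1 \<le> s x" 
        using s_pos s_mono that by (auto simp: mono_on_def)
      have "s x powr (1/2) = s x powr (-1/2) * s x"
        using s1 by (simp flip: powr_add add: powr_mult_base mult.commute)
      also have "\<dots> \<le> s 1 powr (-1/2) * s x"
        using s1 by (intro mult_right_mono powr_mono2') auto
      finally have "s x powr (1/2) * cmod (f x) \<le> s 1 powr (-1/2) * (s x * cmod (f x))"
        by (simp add: mult_right_mono flip: mult.assoc)
      also have "\<dots> \<le> s 1 powr (-1/2) * (s R powr \<gamma> * g x)"
        using that by (intro mult_left_mono sf_le) auto
      finally show ?thesis by (simp add: mult.assoc)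
    qed
    have "(\<integral>\<^sup>+x\<in>{1<..}. ennreal (s x powr (1/2) * cmod (f x)) \<partial>lebesgue) 
        \<le> (\<integral>\<^sup>+x. ennreal (s 1 powr (-1/2) * s R powr \<gamma> * g x) \<partial>?M)"
      using root_le g_nonneg
      by (subst nn_integral_lebesgue_on_Ioi)
        (auto intro!: nn_integral_mono ennreal_leI simp: indicator_def)
    also have "\<dots> < \<infinity>" by (rule g_dom) simp
    finally have 2: "(\<integral>\<^sup>+x\<in>{1<..}. ennreal (s x powr (1/2) * cmod (f x)) \<partial>lebesgue) < \<infinity>" .
    show ?thesis
      unfolding admissible_def using 1 2 by (auto simp: less_top)
  qed
  have norm_f: "weighted_norm p v (\<lambda>x. complex_of_real (s x powr \<alpha>) * f x) = ennreal (i powr (1 / p))"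
  proof -
    have "v x * cmod (complex_of_real (s x powr \<alpha>) * f x) powr p = g x" if "0 < x" for x
    proof (cases "x \<in> A \<and> v x \<noteq> 0")
      case True
      then have pos: "0 < s x" "0 < v x"
        using s_pos[OF that] v_nonneg[OF that] by auto
      have "cmod (complex_of_real (s x powr \<alpha>) * f x)
          = v x powr (1 - p') * s x powr (\<alpha> + p' * (\<beta> - \<gamma>) + \<gamma> - 1)"
        using True pos 
        by (simp add: f_def g_def norm_mult norm_divide abs_mult powr_add powr_diff)
      then have "v x * cmod (complex_of_real (s x powr \<alpha>) * f x) powr p
          = v x powr (1 + p * (1 - p')) * s x powr (p * (\<alpha> + p' * (\<beta> - \<gamma>) + \<gamma> - 1))"
        using pos by (simp add: powr_mult powr_powr powr_add mult.commute)
      also have "1 + p * (1 - p') = 1 - p'"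
        using p'_mult by (simp add: algebra_simps)
      also have "p * (\<alpha> + p' * (\<beta> - \<gamma>) + \<gamma> - 1) = p' * (\<beta> - \<gamma>)"
      proof -
        have "\<alpha> = 1 - \<beta>" using \<alpha>\<beta> by simp
        then have "p * (\<alpha> + p' * (\<beta> - \<gamma>) + \<gamma> - 1) = (p * p' - p) * (\<beta> - \<gamma>)"
          by (simp only:) (simp add: algebra_simps)
        then show ?thesis using p'_mult by simp
      qed
      finally show ?thesis using True by (simp add: g_def)
    next
      case False
      then show ?thesis using p by (auto simp: f_def g_def)
    qed
    then have "(\<integral>\<^sup>+x\<in>{0<..}. ennreal (v x * cmod (complex_of_real (s x powr \<alpha>) * f x) powr p)
        \<partial>lebesgue) = ?I"
      unfolding I_g by (subst nn_integral_lebesgue_on_Ioi) (auto intro!: nn_integral_cong)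
    then show ?thesis
      using i_nonneg by (simp add: weighted_norm_def I_i)
  qed
  \<comment> \<open>Off \<open>A\<close> the function \<open>f\<close> vanishes, so the integrand of the transform is real and bounded
    below by a multiple of \<open>g\<close> on the whole half-line.\<close>
  have transform_low: "c1 * w y powr (-\<gamma>) * i \<le> cmod (transform s K f y)" if y: "y \<in> B" for y
  proof -
    have y0: "0 < y" using y B by auto
    have [measurable]: "(\<lambda>x. K x y) \<in> borel_measurable ?M"
      using K_meas[OF y0] .
    have K_real: "complex_of_real (s x) * f x * K x y
        = complex_of_real (g x * s x powr \<gamma> * Re (K x y))" if "0 < x" for x
    proof (cases "x \<in> A")
      case True
      then obtain \<kappa> where "K x y = complex_of_real \<kappa>"
        using K_low[OF True y] by (auto elim: Reals_cases)
      then show ?thesis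
        using s_pos[OF that] by (simp add: f_def powr_diff)
    qed (simp add: f_def g_def)
    have int: "integrable ?M (\<lambda>x. g x * s x powr \<gamma> * Re (K x y))"
    proof (rule Bochner_Integration.integrable_bound)
      show "integrable ?M (\<lambda>x. k * s R powr \<gamma> * g x)"
        using g_int by simp
      show "AE x in ?M. norm (g x * s x powr \<gamma> * Re (K x y)) \<le> norm (k * s R powr \<gamma> * g x)"
      proof (intro AE_I2)
        fix x assume "x \<in> space ?M"
        then have x: "0 < x" by simp
        have k: "\<bar>Re (K x y)\<bar> \<le> k"
          using K_bdd[OF x y0] abs_Re_le_cmod[of "K x y"] by linarith
        have "norm (g x * s x powr \<gamma> * Re (K x y)) = g x * s x powr \<gamma> * \<bar>Re (K x y)\<bar>"
          using g_nonneg[of x] by (simp add: abs_mult)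
        also have "\<dots> \<le> (s R powr \<gamma> * g x) * k"
          using mult_mono[OF sf_le[OF x, unfolded sf[OF x]] k] g_nonneg[of x] by simp
        also have "\<dots> \<le> norm (k * s R powr \<gamma> * g x)"
          by (simp add: mult_ac)
        finally show "norm (g x * s x powr \<gamma> * Re (K x y)) \<le> norm (k * s R powr \<gamma> * g x)" .
      qed
    qed measurable
    have "c1 * w y powr (-\<gamma>) * i = (LINT x|?M. c1 * w y powr (-\<gamma>) * g x)"
      by (simp add: i_def)
    also have "\<dots> \<le> (LINT x|?M. g x * s x powr \<gamma> * Re (K x y))"
    proof (rule integral_mono[OF _ int])
      show "integrable ?M (\<lambda>x. c1 * w y powr (-\<gamma>) * g x)"
        using g_int by simp
      fix x assume "x \<in> space ?M"
      then have x: "0 < x" by simp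
      show "c1 * w y powr (-\<gamma>) * g x \<le> g x * s x powr \<gamma> * Re (K x y)"
      proof (cases "x \<in> A")
        case True
        have "c1 * w y powr (-\<gamma>) * g x = g x * s x powr \<gamma> * (c1 * (s x * w y) powr (-\<gamma>))"
          using s_pos[OF x] w_pos[OF y0] by (simp add: powr_mult powr_minus)
        also have "\<dots> \<le> g x * s x powr \<gamma> * Re (K x y)"
          using K_low[OF True y] g_nonneg[of x] by (intro mult_left_mono) auto
        finally show ?thesis .
      qed (simp add: g_def)
    qed
    also have "\<dots> \<le> cmod (transform s K f y)"
    proof -
      have "transform s K f y = (LINT x|?M. complex_of_real (g x * s x powr \<gamma> * Re (K x y)))"
        unfolding transform_def using K_real by (intro Bochner_Integration.integral_cong) auto
      also have "\<dots> = complex_of_real (LINT x|?M. g x * s x powr \<gamma> * Re (K x y))"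
        by (rule integral_complex_of_real)
      finally show ?thesis by simp
    qed
    finally show ?thesis .
  qed
  have J_M: "?J = (\<integral>\<^sup>+y. ennreal (u y * w y powr (q * (\<beta> - \<gamma>))) * indicator B y \<partial>?M)"
    by (rule nn_integral_lebesgue_on_Ioi[OF B(2)])
  have "ennreal (c1 * i) * ennpow ?J (1 / q)
      = ennpow (ennreal ((c1 * i) powr q) * ?J) (1 / q)"
    using q c1 i_nonneg by (simp add: ennpow_mult powr_powr)
  also have "\<dots> \<le> weighted_norm q u (\<lambda>y. complex_of_real (w y powr \<beta>) * transform s K f y)"
    unfolding weighted_norm_def
  proof (rule ennpow_mono)
    have "ennreal ((c1 * i) powr q) * ?J
        = (\<integral>\<^sup>+y. ennreal ((c1 * i) powr q) * (ennreal (u y * w y powr (q * (\<beta> - \<gamma>))) * indicator B y) \<partial>?M)"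
      unfolding J_M by (rule nn_integral_cmult[symmetric]) measurable
    also have "\<dots> \<le> (\<integral>\<^sup>+y. ennreal (u y * cmod (complex_of_real (w y powr \<beta>) * transform s K f y)
        powr q) * indicator {0<..} y \<partial>?M)"
    proof (rule nn_integral_mono)
      fix y assume "y \<in> space ?M"
      then have y0: "0 < y" by simp
      show "ennreal ((c1 * i) powr q) * (ennreal (u y * w y powr (q * (\<beta> - \<gamma>))) * indicator B y)
        \<le> ennreal (u y * cmod (complex_of_real (w y powr \<beta>) * transform s K f y)
        powr q) * indicator {0<..} y"
      proof (cases "y \<in> B")
        case True
        have "w y powr \<beta> * (c1 * w y powr (-\<gamma>) * i) = (c1 * i) * w y powr (\<beta> - \<gamma>)"
          using w_pos[OF y0] by (simp add: powr_diff powr_minus field_simps)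
        then have "(c1 * i) powr q * (u y * w y powr (q * (\<beta> - \<gamma>)))
            = u y * (w y powr \<beta> * (c1 * w y powr (-\<gamma>) * i)) powr q"
          using w_pos[OF y0] c1 i_nonneg
          by (simp only: powr_mult powr_powr mult_ac)
        also have "\<dots> \<le> u y * (w y powr \<beta> * cmod (transform s K f y)) powr q"
          using transform_low[OF True] u_nonneg[OF y0] c1 i_nonneg q
          by (intro mult_left_mono powr_mono2) auto
        finally show ?thesis
          using True y0 u_nonneg[OF y0]
          by (simp add: norm_mult flip: ennreal_mult) 
      qed auto
    qed
    also have "\<dots> = (\<integral>\<^sup>+y\<in>{0<..}. ennreal (u y * cmod (complex_of_real (w y powr \<beta>)
        * transform s K f y) powr q) \<partial>lebesgue)"
      by (rule nn_integral_lebesgue_on_Ioi[symmetric]) simp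
    finally show "ennreal ((c1 * i) powr q) * ?J \<le> \<dots>" .
  qed (use q in simp)
  also have "\<dots> \<le> ennreal c * ennreal (i powr (1 / p))"
    using ineq[OF f_adm] unfolding norm_f .
  finally have main: "ennreal (c1 * i) * ennpow ?J (1 / q) \<le> ennreal c * ennreal (i powr (1 / p))" .
  show ?thesis
  proof (cases "i = 0")
    case True
    then show ?thesis by (simp add: I_i)
  next
    case False
    then have i: "0 < i" using i_nonneg by simp
    have "1 / p' = - 1 / p + 1" using p'p by simp
    then have exps: "i powr (1 / p') = i powr (- 1 / p) * i" 
      using i by (simp only: powr_add powr_one)
    \<comment> \<open>Multiplying by \<open>d\<close> is the division by \<open>c1 * i powr (1/p)\<close>, done by a real factor because
      \<open>?J\<close> may be infinite.\<close>
    define d where "d = i powr (- 1 / p) / c1"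
    have d: "0 < d" using i c1 by (simp add: d_def)
    have d1: "i powr (1 / p') = d * (c1 * i)" and d2: "d * (c * i powr (1 / p)) = c / c1"
      using c1 i exps by (simp_all add: d_def field_simps flip: powr_add)
    have "ennpow ?J (1 / q) * ennpow ?I (1 / p') = ennreal (d * (c1 * i)) * ennpow ?J (1 / q)"
      unfolding d1[symmetric] I_i using i_nonneg by (simp add: mult.commute)
    also have "\<dots> = ennreal d * (ennreal (c1 * i) * ennpow ?J (1 / q))"
      using d c1 i by (simp add: ennreal_mult mult.assoc)
    also have "\<dots> \<le> ennreal d * (ennreal c * ennreal (i powr (1 / p)))"
      by (rule mult_left_mono[OF main]) simp
    also have "\<dots> = ennreal (c / c1)"
      using d c unfolding d2[symmetric] by (simp add: ennreal_mult)
    finally show ?thesis .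
  qed
qed

section \<open>Necessity of the weight conditions\<close>

theorem theorem3p3:
  fixes s w u v :: "real \<Rightarrow> real"
    and K :: "real \<Rightarrow> real \<Rightarrow> complex"
    and p p' q :: real
    and a a' :: ereal
  assumes s_pos: "\<And>x. 0 < x \<Longrightarrow> 0 < s x"
    and w_pos: "\<And>y. 0 < y \<Longrightarrow> 0 < w y"
    and s_mono: "mono_on {0<..} s"
    and w_mono: "mono_on {0<..} w"
    and s_loc: "loc_integrable (\<lambda>x. ennreal (s x))"
    and K_cont: "continuous_on ({0<..} \<times> {0<..}) (\<lambda>(x, y). K x y)"
    and K_bound: "\<exists>c>0. \<forall>x>0. \<forall>y>0. cmod (K x y) \<le> c * min 1 ((s x * w y) powr (-1/2))"
    and p: "1 < p" and p': "p' = p / (p - 1)"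
    and q: "1 < q"
    and a: "1 \<le> a" and a': "a' = dual_exponent a"
    and u_meas: "u \<in> borel_measurable (lebesgue_on {0<..})"
    and u_nonneg: "\<And>y. 0 < y \<Longrightarrow> 0 \<le> u y"
    and v_meas: "v \<in> borel_measurable (lebesgue_on {0<..})"
    and v_nonneg: "\<And>x. 0 < x \<Longrightarrow> 0 \<le> v x"
    and u_loc: "loc_integrable (\<lambda>y. ennreal (u y * w y powr (q * recip a')))"
    and v_loc: "loc_integrable (\<lambda>x. negpow (v x) (1 - p') * ennreal (s x powr (p' * recip a')))"
    and ineq: "\<exists>c>0. \<forall>f. admissible s f \<longrightarrow>
        weighted_norm q u (\<lambda>y. complex_of_real (w y powr recip a') * transform s K f y)
          \<le> ennreal c * weighted_norm p v (\<lambda>x. complex_of_real (s x powr recip a) * f x)"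
  shows "(comparable_on {(x, y). 0 < x \<and> 0 < y \<and> x * y \<le> 1} K (\<lambda>x y. 1) \<longrightarrow>
      (\<exists>C>0. (SUP r\<in>{0<..}.
          ennpow (\<integral>\<^sup>+y\<in>{0<..<1/r}. ennreal (u y * w y powr (q * recip a')) \<partial>lebesgue) (1 / q)
        * ennpow (\<integral>\<^sup>+x\<in>{0<..<r}. negpow (v x) (1 - p') * ennreal (s x powr (p' * recip a'))
            \<partial>lebesgue) (1 / p'))
        \<le> ennreal C))
    \<and> (comparable_on {(x, y). 0 < x \<and> 0 < y \<and> 1 < x * y} K (\<lambda>x y. (s x * w y) powr (-1/2)) \<longrightarrow>
      (\<exists>C>0. (SUP r\<in>{0<..}.
          ennpow (\<integral>\<^sup>+y\<in>{1/r<..}. ennreal (u y * w y powr (q * (recip a' - 1/2))) \<partial>lebesgue) (1 / q)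
        * ennpow (\<integral>\<^sup>+x\<in>{r<..}. negpow (v x) (1 - p') * ennreal (s x powr (p' * (recip a' - 1/2)))
            \<partial>lebesgue) (1 / p'))
        \<le> ennreal C))"
proof -
  define \<alpha> \<beta> where "\<alpha> = recip a" and "\<beta> = recip a'"
  have \<alpha>\<beta>: "\<alpha> + \<beta> = 1"
    unfolding \<alpha>_def \<beta>_def a' by (rule recip_add_recip_dual_exponent[OF a])
  have p'1: "1 < p'"
    using p by (simp add: p' field_simps)
  obtain c where c: "0 < c" and c_ineq: "\<And>f. admissible s f \<Longrightarrow>
        weighted_norm q u (\<lambda>y. complex_of_real (w y powr \<beta>) * transform s K f y)
          \<le> ennreal c * weighted_norm p v (\<lambda>x. complex_of_real (s x powr \<alpha>) * f x)"
    using ineq unfolding \<alpha>_def \<beta>_def by blast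
  obtain k where k: "0 < k"
    and k_bound: "\<And>x y. 0 < x \<Longrightarrow> 0 < y \<Longrightarrow> cmod (K x y) \<le> k * min 1 ((s x * w y) powr (-1/2))"
    using K_bound by blast
  have K_bdd: "cmod (K x y) \<le> k" if "0 < x" "0 < y" for x y
  proof -
    have "k * min 1 ((s x * w y) powr (-1/2)) \<le> k * 1"
      using k by (intro mult_left_mono) auto
    then show ?thesis using k_bound[OF that] by simp
  qed
  have K_meas: "(\<lambda>x. K x y) \<in> borel_measurable (lebesgue_on {0<..})" if "0 < y" for y
  proof (rule continuous_imp_measurable_on_sets_lebesgue)
    have "continuous_on {0<..} (\<lambda>x. (x, y))"
      by (intro continuous_intros)
    then have "continuous_on {0<..} (\<lambda>x. case (x, y) of (x, y) \<Rightarrow> K x y)"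
      by (rule continuous_on_compose2[OF K_cont]) (use that in auto)
    then show "continuous_on {0<..} (\<lambda>x. K x y)" by simp
  qed auto
  have v_fin: "(\<integral>\<^sup>+x\<in>{0<..b}. negpow (v x) (1 - p') * ennreal (s x powr (p' * \<beta>)) \<partial>lebesgue) < \<infinity>"
    if "0 < b" for b
    using v_loc that unfolding loc_integrable_def \<beta>_def by blast
  have bound: "ennpow (\<integral>\<^sup>+y\<in>B. ennreal (u y * w y powr (q * (\<beta> - \<gamma>))) \<partial>lebesgue) (1 / q)
      * ennpow (\<integral>\<^sup>+x\<in>A. negpow (v x) (1 - p') * ennreal (s x powr (p' * (\<beta> - \<gamma>)))
          \<partial>lebesgue) (1 / p') \<le> ennreal (c / c1)"
    if "0 \<le> \<gamma>" "0 < c1" "A \<in> sets borel" "A \<subseteq> {0<..R}" "B \<in> sets borel" "B \<subseteq> {0<..}"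
      "\<And>x y. x \<in> A \<Longrightarrow> y \<in> B \<Longrightarrow> K x y \<in> \<real> \<and> c1 * (s x * w y) powr (-\<gamma>) \<le> Re (K x y)"
      "(\<integral>\<^sup>+x\<in>A. negpow (v x) (1 - p') * ennreal (s x powr (p' * (\<beta> - \<gamma>))) \<partial>lebesgue) < \<infinity>"
    for \<gamma> c1 R A B
  proof -
    have "0 < q" using q by simp
    show ?thesis
      by (rule test_function_bound[OF s_pos w_pos s_mono w_mono K_meas K_bdd p p' \<open>0 < q\<close> \<alpha>\<beta> that(1)
          u_meas u_nonneg v_meas v_nonneg c_ineq c that(2-)])
  qed
  have part1: "\<exists>C>0. (SUP r\<in>{0<..}.
          ennpow (\<integral>\<^sup>+y\<in>{0<..<1/r}. ennreal (u y * w y powr (q * \<beta>)) \<partial>lebesgue) (1 / q)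
        * ennpow (\<integral>\<^sup>+x\<in>{0<..<r}. negpow (v x) (1 - p') * ennreal (s x powr (p' * \<beta>))
            \<partial>lebesgue) (1 / p')) \<le> ennreal C"
    if K: "comparable_on {(x, y). 0 < x \<and> 0 < y \<and> x * y \<le> 1} K (\<lambda>x y. 1)"
  proof -
    obtain c1 where c1: "0 < c1" and K_low: "\<And>x y. 0 < x \<Longrightarrow> 0 < y \<Longrightarrow> x * y \<le> 1 \<Longrightarrow>
        K x y \<in> \<real> \<and> c1 \<le> Re (K x y)"
      using K unfolding comparable_on_def by fastforce
    have "ennpow (\<integral>\<^sup>+y\<in>{0<..<1/r}. ennreal (u y * w y powr (q * \<beta>)) \<partial>lebesgue) (1 / q)
        * ennpow (\<integral>\<^sup>+x\<in>{0<..<r}. negpow (v x) (1 - p') * ennreal (s x powr (p' * \<beta>))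
            \<partial>lebesgue) (1 / p') \<le> ennreal (c / c1)" if r: "0 < r" for r
    proof -
      have low: "K x y \<in> \<real> \<and> c1 * (s x * w y) powr (- 0) \<le> Re (K x y)"
        if "x \<in> {0<..<r}" "y \<in> {0<..<1/r}" for x y
      proof -
        have "x * y \<le> r * (1 / r)" using that r by (intro mult_mono) auto
        then have "x * y \<le> 1" using r by simp
        moreover have "0 < s x * w y" using that s_pos w_pos by simp
        ultimately show ?thesis using K_low[of x y] that c1 by auto
      qed
      have fin: "(\<integral>\<^sup>+x\<in>{0<..<r}. negpow (v x) (1 - p') * ennreal (s x powr (p' * (\<beta> - 0)))
          \<partial>lebesgue) < \<infinity>"
      proof (rule le_less_trans[OF _ v_fin[OF r]])
        show "(\<integral>\<^sup>+x\<in>{0<..<r}. negpow (v x) (1 - p') * ennreal (s x powr (p' * (\<beta> - 0)))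
            \<partial>lebesgue) \<le> (\<integral>\<^sup>+x\<in>{0<..r}. negpow (v x) (1 - p') * ennreal (s x powr (p' * \<beta>)) \<partial>lebesgue)"
          by (intro nn_integral_mono) (auto simp: indicator_def)
      qed
      have sub: "{0<..<r} \<subseteq> {0<..r}" "{0<..<1/r} \<subseteq> {0<..}" by auto
      show ?thesis
        using bound[where \<gamma> = 0, OF _ c1 _ sub(1) _ sub(2) low fin] by simp
    qed
    then have "(SUP r\<in>{0<..}.
          ennpow (\<integral>\<^sup>+y\<in>{0<..<1/r}. ennreal (u y * w y powr (q * \<beta>)) \<partial>lebesgue) (1 / q)
        * ennpow (\<integral>\<^sup>+x\<in>{0<..<r}. negpow (v x) (1 - p') * ennreal (s x powr (p' * \<beta>))
            \<partial>lebesgue) (1 / p')) \<le> ennreal (c / c1)"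
      by (intro SUP_least) auto
    then show ?thesis using c c1 by (intro exI[of _ "c / c1"]) auto
  qed
  have part2: "\<exists>C>0. (SUP r\<in>{0<..}.
          ennpow (\<integral>\<^sup>+y\<in>{1/r<..}. ennreal (u y * w y powr (q * (\<beta> - 1/2))) \<partial>lebesgue) (1 / q)
        * ennpow (\<integral>\<^sup>+x\<in>{r<..}. negpow (v x) (1 - p') * ennreal (s x powr (p' * (\<beta> - 1/2)))
            \<partial>lebesgue) (1 / p')) \<le> ennreal C"
    if K: "comparable_on {(x, y). 0 < x \<and> 0 < y \<and> 1 < x * y} K (\<lambda>x y. (s x * w y) powr (-1/2))"
  proof -
    obtain c1 where c1: "0 < c1" and K_low: "\<And>x y. 0 < x \<Longrightarrow> 0 < y \<Longrightarrow> 1 < x * y \<Longrightarrow>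
        K x y \<in> \<real> \<and> c1 * (s x * w y) powr (-1/2) \<le> Re (K x y)"
      using K unfolding comparable_on_def by fastforce
    have "ennpow (\<integral>\<^sup>+y\<in>{1/r<..}. ennreal (u y * w y powr (q * (\<beta> - 1/2))) \<partial>lebesgue) (1 / q)
        * ennpow (\<integral>\<^sup>+x\<in>{r<..}. negpow (v x) (1 - p') * ennreal (s x powr (p' * (\<beta> - 1/2)))
            \<partial>lebesgue) (1 / p') \<le> ennreal (c / c1)" (is "ennpow ?J _ * ennpow ?I _ \<le> _")
      if r: "0 < r" for r
    proof -
      let ?h = "\<lambda>x. negpow (v x) (1 - p') * ennreal (s x powr (p' * (\<beta> - 1/2)))"
      let ?I_n = "\<lambda>n. \<integral>\<^sup>+x\<in>{r<..r + real n}. ?h x \<partial>lebesgue"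
      have trunc: "ennpow ?J (1 / q) * ennpow (?I_n n) (1 / p') \<le> ennreal (c / c1)" for n
      proof -
        let ?R = "r + real n"
        have low: "K x y \<in> \<real> \<and> c1 * (s x * w y) powr (- (1/2)) \<le> Re (K x y)"
          if "x \<in> {r<..?R}" "y \<in> {1/r<..}" for x y
        proof -
          have y: "0 < y" using that r by (auto intro: less_trans[of 0 "1 / r"])
          have "r * (1 / r) < x * y" using that r by (intro mult_strict_mono) auto
          then have "1 < x * y" using r by simp
          then show ?thesis using K_low[of x y] that r y by auto
        qed
        have "0 < ?R" using r by simp
        \<comment> \<open>Since \<open>s \<ge> s(r)\<close> to the right of \<open>r\<close>, the extra factor \<open>s powr (-p'/2)\<close> is bounded there,
          and the local integrability assumed without it suffices.\<close>
        let ?d = "ennreal (s r powr (- (p' / 2)))"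
        have h_le: "?h x \<le> ?d * (negpow (v x) (1 - p') * ennreal (s x powr (p' * \<beta>)))"
          if "r < x" for x
        proof -
          have sx: "0 < s r" "s r \<le> s x"
            using s_pos s_mono r that by (auto simp: mono_on_def)
          have "s x powr (p' * (\<beta> - 1/2)) = s x powr (- (p' / 2)) * s x powr (p' * \<beta>)"
            by (simp add: right_diff_distrib' flip: powr_add)
          also have "\<dots> \<le> s r powr (- (p' / 2)) * s x powr (p' * \<beta>)"
            using sx p'1 by (intro mult_right_mono powr_mono2') auto
          finally have "ennreal (s x powr (p' * (\<beta> - 1/2))) \<le> ?d * ennreal (s x powr (p' * \<beta>))"
            by (simp add: ennreal_leI flip: ennreal_mult)
          then show ?thesis
            by (metis mult.left_commute mult_left_mono zero_le)
        qed
        have "(\<integral>\<^sup>+x\<in>{r<..?R}. ?h x \<partial>lebesgue)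
            \<le> (\<integral>\<^sup>+x. ?d * (negpow (v x) (1 - p') * ennreal (s x powr (p' * \<beta>)) * indicator {0<..?R} x) \<partial>lebesgue_on {0<..})"
          using r by (subst nn_integral_lebesgue_on_Ioi)
            (auto intro!: nn_integral_mono h_le simp: indicator_def)
        also have "\<dots> = ?d * (\<integral>\<^sup>+x. negpow (v x) (1 - p') * ennreal (s x powr (p' * \<beta>)) * indicator {0<..?R} x \<partial>lebesgue_on {0<..})"
        proof (rule nn_integral_cmult)
          have "{0<..?R} \<in> sets (lebesgue_on {0<..})"
            by (intro sets_lebesgue_on_Ioi) auto
          moreover have "(\<lambda>x. negpow (v x) (1 - p') * ennreal (s x powr (p' * \<beta>)))
              \<in> borel_measurable (lebesgue_on {0<..})"
            using v_loc unfolding loc_integrable_def \<beta>_def by blast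
          ultimately show "(\<lambda>x. negpow (v x) (1 - p') * ennreal (s x powr (p' * \<beta>))
              * indicator {0<..?R} x) \<in> borel_measurable (lebesgue_on {0<..})"
            by measurable
        qed
        also have "\<dots> = ?d * (\<integral>\<^sup>+x\<in>{0<..?R}. negpow (v x) (1 - p') * ennreal (s x powr (p' * \<beta>)) \<partial>lebesgue)"
          by (subst nn_integral_lebesgue_on_Ioi) auto
        also have "\<dots> < \<infinity>"
          using v_fin[OF \<open>0 < ?R\<close>] by (simp add: ennreal_mult_less_top less_top)
        finally have fin: "?I_n n < \<infinity>" .
        have sub: "{r<..?R} \<subseteq> {0<..?R}" "{1/r<..} \<subseteq> {0<..}"
          using r by (auto intro: less_trans[of 0 "1 / r"])
        show ?thesis
          using bound[where \<gamma> = "1/2", OF _ c1 _ sub(1) _ sub(2) low fin] by simp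
      qed
      have "?I = (SUP n. ?I_n n)"
      proof -
        have h_meas: "?h \<in> borel_measurable (lebesgue_on {0<..})"
          using v_meas mono_on_measurable_Ioi[OF s_mono] unfolding negpow_def by measurable
        have "?I = (\<integral>\<^sup>+x. (SUP n. ?h x * indicator {r<..r + real n} x) \<partial>lebesgue_on {0<..})"
        proof (subst nn_integral_lebesgue_on_Ioi)
          have "(SUP n. ?h x * indicator {r<..r + real n} x) = ?h x * indicator {r<..} x" for x
          proof (rule antisym)
            show "(SUP n. ?h x * indicator {r<..r + real n} x) \<le> ?h x * indicator {r<..} x"
              by (intro SUP_least) (auto simp: indicator_def)
            obtain n where "x - r \<le> real n" using real_arch_simple by blast
            then have le: "?h x * indicator {r<..} x \<le> ?h x * indicator {r<..r + real n} x"
              by (auto simp: indicator_def)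
            show "?h x * indicator {r<..} x \<le> (SUP n. ?h x * indicator {r<..r + real n} x)"
              by (rule SUP_upper2[of n]) (use le in auto)
          qed
          then show "(\<integral>\<^sup>+x. ?h x * indicator {r<..} x \<partial>lebesgue_on {0<..})
              = (\<integral>\<^sup>+x. (SUP n. ?h x * indicator {r<..r + real n} x) \<partial>lebesgue_on {0<..})"
            by simp
        qed (use r in auto)
        also have "\<dots> = (SUP n. \<integral>\<^sup>+x. ?h x * indicator {r<..r + real n} x \<partial>lebesgue_on {0<..})"
        proof (rule nn_integral_monotone_convergence_SUP)
          show "incseq (\<lambda>n x. ?h x * indicator {r<..r + real n} x)"
            by (auto simp: incseq_def le_fun_def indicator_def)
          fix n
          have "{r<..r + real n} \<in> sets (lebesgue_on {0<..})"
            using r by (intro sets_lebesgue_on_Ioi) auto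
          then show "(\<lambda>x. ?h x * indicator {r<..r + real n} x) \<in> borel_measurable (lebesgue_on {0<..})"
            using h_meas by measurable
        qed
        also have "\<dots> = (SUP n. ?I_n n)"
          using r by (intro SUP_cong refl nn_integral_lebesgue_on_Ioi[symmetric]) auto
        finally show ?thesis .
      qed
      then have "ennpow ?J (1 / q) * ennpow ?I (1 / p')
          = (SUP n. ennpow ?J (1 / q) * ennpow (?I_n n) (1 / p'))"
        using p'1 by (simp add: ennpow_SUP SUP_mult_left_ennreal)
      also have "\<dots> \<le> ennreal (c / c1)"
        by (rule SUP_least) (rule trunc)
      finally show ?thesis .
    qed
    then have "(SUP r\<in>{0<..}.
          ennpow (\<integral>\<^sup>+y\<in>{1/r<..}. ennreal (u y * w y powr (q * (\<beta> - 1/2))) \<partial>lebesgue) (1 / q)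
        * ennpow (\<integral>\<^sup>+x\<in>{r<..}. negpow (v x) (1 - p') * ennreal (s x powr (p' * (\<beta> - 1/2)))
            \<partial>lebesgue) (1 / p')) \<le> ennreal (c / c1)"
      by (intro SUP_least) auto
    then show ?thesis using c c1 by (intro exI[of _ "c / c1"]) auto
  qed
  show ?thesis
    using part1 part2 unfolding \<beta>_def by blast
qed

end
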